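(* Let $\mathrm{Prod}$ denote the set of Markov chains on $\Omega^N$ whose transition probabilities are product distributions over the positions conditioned on the current state, i.e. $\mathbb{P}(\tau_1\cdots\tau_N,\ \tau'_1\cdots\tau'_N)=\prod_{i=1}^N\mathbb{P}(\tau'_i\mid\tau_1\cdots\tau_N)$. Let $\mathcal{T}_{PD}$ denote the class of Markov chains on $\Omega^N$ defined by parallel decoding Transformers. Then $\mathcal{T}_{PD}=\mathrm{Prod}$.
   Context: $\Omega$ is a finite vocabulary, identified with $\{1,\dots,|\Omega|\}$; $N$ is the sequence length. For an input $\tau_1\cdots\tau_N\in\Omega^N$, the encoder is $g_{enc}(\tau_1\cdots\tau_N)=E+P\in\mathbb{R}^{d\times N}$, where column $j$ of $E$ is the ($d$-dimensional) token embedding of $\tau_j$ and column $j$ of $P$ is the positional embedding of position $j$. Column-wise softmax: $\sigma(A)_{ij}=\exp(A_{ij})/\sum_l\exp(A_{lj})$. A Transformer block (with $h$ heads, head size $m$, hidden size $r$) maps $X\in\mathbb{R}^{d\times N}$ to $$t(X)=\mathrm{Attn}(X)+W_2\,\mathrm{ReLU}(W_1\mathrm{Attn}(X)+b_1\mathbf{1}_N^T)+b_2\mathbf{1}_N^T,$$ $$\mathrm{Attn}(X)=X+\sum_{i=1}^hW_O^iW_V^iX\cdot\sigma\big[(W_K^iX)^TW_Q^iX\big],$$ with $W_O^i\in\mathbb{R}^{d\times m}$, $W_V^i,W_K^i,W_Q^i\in\mathbb{R}^{m\times d}$, $W_2\in\mathbb{R}^{d\times r}$, $W_1\in\mathbb{R}^{r\times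 d}$, $b_2\in\mathbb{R}^d$, $b_1\in\mathbb{R}^r$. A Transformer $g_{tr}$ is a finite composition of Transformer blocks. The prediction map is $g_{pred}(X)=\sigma(W^{pred}g_{tr}(X)+b^{pred})\in(0,1)^{|\Omega|\times N}$ with $W^{pred}\in\mathbb{R}^{|\Omega|\times d}$, $b^{pred}\in\mathbb{R}^{|\Omega|}$ (added to each column). A sampling function is a postprocessing map $s:(0,1)^{|\Omega|}\to[0,1]^{|\Omega|}$ with values in probability vectors, applied to each column (e.g. the identity, truncation of the low-probability tail, or argmax). A parallel decoding Transformer is $g=s\circ g_{pred}\circ g_{enc}:\Omega^N\to[0,1]^{|\Omega|\times N}$, where the depth, all widths ($d,h,m,r$), all weights and embeddings, and $s$ may be chosen arbitrarily. It defines the Markov chain on $\Omega^N$ with transition probabilities $$\mathbb{P}(\tau_1\cdots\tau_N,\tau'_1\cdots\tau'_N)=\prod_{j=1}^Ng(\tau_1\cdots\tau_N)_{\tau'_j,j}.$$ $\mathcal{T}_{PD}$ is identified with the set of all Markov chains arising this way. *)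

theory Defs
  imports Complex_Main "HOL-Library.FuncSet" "Jordan_Normal_Form.Matrix"
begin

text \<open>Conventions: the vocabulary of size \<open>K\<close> is \<open>{..<K}\<close>, positions are \<open>{..<N}\<close>
  (indices start at 0), and real matrices of unrestricted dimensions are those of
  \<^theory>\<open>Jordan_Normal_Form.Matrix\<close>.\<close>

definition sequences :: "nat \<Rightarrow> nat \<Rightarrow> (nat \<Rightarrow> nat) set" where
  "sequences K N = {..<N} \<rightarrow>\<^sub>E {..<K}"

text \<open>A chain is identified with its transition probabilities, taken as an extensional function
  on the state space so that equality of chains is equality of functions.\<close>

type_synonym chain = "(nat \<Rightarrow> nat) \<Rightarrow> (nat \<Rightarrow> nat) \<Rightarrow> real"

definition markov_chain :: "nat \<Rightarrow> nat \<Rightarrow> chain \<Rightarrow> bool" where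
  "markov_chain K N P \<longleftrightarrow>
     P \<in> sequences K N \<rightarrow>\<^sub>E (sequences K N \<rightarrow>\<^sub>E {0..}) \<and>
     (\<forall>\<tau>\<in>sequences K N. (\<Sum>\<tau>'\<in>sequences K N. P \<tau> \<tau>') = 1)"

text \<open>The conditional probability, given the current state \<open>\<tau>\<close>, that the next state has token
  \<open>a\<close> at position \<open>i\<close>.\<close>

definition token_prob :: "nat \<Rightarrow> nat \<Rightarrow> chain \<Rightarrow> (nat \<Rightarrow> nat) \<Rightarrow> nat \<Rightarrow> nat \<Rightarrow> real" where
  "token_prob K N P \<tau> i a = (\<Sum>\<tau>' \<in> {\<tau>' \<in> sequences K N. \<tau>' i = a}. P \<tau> \<tau>')"

definition Prod_chains :: "nat \<Rightarrow> nat \<Rightarrow> chain set" where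
  "Prod_chains K N = {P. markov_chain K N P \<and>
     (\<forall>\<tau>\<in>sequences K N. \<forall>\<tau>'\<in>sequences K N.
        P \<tau> \<tau>' = (\<Prod>i<N. token_prob K N P \<tau> i (\<tau>' i)))}"

definition softmax :: "real mat \<Rightarrow> real mat" where
  "softmax A = mat (dim_row A) (dim_col A)
     (\<lambda>(i, j). exp (A $$ (i, j)) / (\<Sum>l<dim_row A. exp (A $$ (l, j))))"

definition ReLU :: "real mat \<Rightarrow> real mat" where
  "ReLU = map_mat (\<lambda>x. max 0 x)"

text \<open>The matrix \<open>b 1\<^sub>n\<^sup>T\<close>, all of whose \<open>n\<close> columns are \<open>b\<close>.\<close>

definition bias :: "real vec \<Rightarrow> nat \<Rightarrow> real mat" where
  "bias b n = mat (dim_vec b) n (\<lambda>(i, j). b $ i)"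

record head =
  W_O :: "real mat"
  W_V :: "real mat"
  W_K :: "real mat"
  W_Q :: "real mat"

record block =
  heads :: "head list"
  W_1 :: "real mat"
  b_1 :: "real vec"
  W_2 :: "real mat"
  b_2 :: "real vec"

definition head_dims :: "nat \<Rightarrow> nat \<Rightarrow> head \<Rightarrow> bool" where
  "head_dims d m H \<longleftrightarrow>
     W_O H \<in> carrier_mat d m \<and> W_V H \<in> carrier_mat m d \<and>
     W_K H \<in> carrier_mat m d \<and> W_Q H \<in> carrier_mat m d"

definition block_dims :: "nat \<Rightarrow> nat \<Rightarrow> nat \<Rightarrow> nat \<Rightarrow> block \<Rightarrow> bool" where
  "block_dims d h m r B \<longleftrightarrow>
     length (heads B) = h \<and> (\<forall>H\<in>set (heads B). head_dims d m H) \<and>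
     W_1 B \<in> carrier_mat r d \<and> b_1 B \<in> carrier_vec r \<and>
     W_2 B \<in> carrier_mat d r \<and> b_2 B \<in> carrier_vec d"

definition head_map :: "head \<Rightarrow> real mat \<Rightarrow> real mat" where
  "head_map H X = W_O H * (W_V H * X) * softmax ((W_K H * X)\<^sup>T * (W_Q H * X))"

definition Attn :: "head list \<Rightarrow> real mat \<Rightarrow> real mat" where
  "Attn Hs X = X + foldr (\<lambda>H S. head_map H X + S) Hs (0\<^sub>m (dim_row X) (dim_col X))"

definition block_map :: "block \<Rightarrow> real mat \<Rightarrow> real mat" where
  "block_map B X = (let A = Attn (heads B) X; n = dim_col X in
     A + W_2 B * ReLU (W_1 B * A + bias (b_1 B) n) + bias (b_2 B) n)"

definition transformer :: "block list \<Rightarrow> real mat \<Rightarrow> real mat" where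
  "transformer Bs = fold block_map Bs"

text \<open>\<open>T\<close> holds the token embeddings and \<open>Q\<close> the positional embeddings as columns.\<close>

definition g_enc :: "real mat \<Rightarrow> real mat \<Rightarrow> (nat \<Rightarrow> nat) \<Rightarrow> real mat" where
  "g_enc T Q \<tau> = mat (dim_row Q) (dim_col Q) (\<lambda>(i, j). T $$ (i, \<tau> j)) + Q"

definition g_pred :: "real mat \<Rightarrow> real vec \<Rightarrow> block list \<Rightarrow> real mat \<Rightarrow> real mat" where
  "g_pred W b Bs X = softmax (W * transformer Bs X + bias b (dim_col X))"

text \<open>Only the values of \<open>s\<close> on the outputs of a softmax matter. These have entries in \<open>(0,1)\<close>
  if \<open>K \<ge> 2\<close>, and the single entry 1 if \<open>K = 1\<close>; the domain \<open>(0,1]\<^sup>K\<close> covers both cases.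
  For \<open>K \<ge> 2\<close> this gives the same chains as the domain \<open>(0,1)\<^sup>K\<close>, since any map on the smaller
  domain extends.\<close>

definition sampling_function :: "nat \<Rightarrow> (real vec \<Rightarrow> real vec) \<Rightarrow> bool" where
  "sampling_function K s \<longleftrightarrow>
     (\<forall>p\<in>carrier_vec K. (\<forall>i<K. 0 < p $ i \<and> p $ i \<le> 1) \<longrightarrow>
        s p \<in> carrier_vec K \<and> (\<forall>i<K. 0 \<le> s p $ i) \<and> (\<Sum>i<K. s p $ i) = 1)"

definition apply_cols :: "(real vec \<Rightarrow> real vec) \<Rightarrow> real mat \<Rightarrow> real mat" where
  "apply_cols s A = mat (dim_row A) (dim_col A) (\<lambda>(i, j). s (col A j) $ i)"

text \<open>Depth and widths are arbitrary but positive, and \<open>h\<close>, \<open>m\<close>, \<open>r\<close> are common to all blocks.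
  Padding with zero weights shows that neither convention affects the resulting chains.\<close>

definition parallel_decoder :: "nat \<Rightarrow> nat \<Rightarrow> ((nat \<Rightarrow> nat) \<Rightarrow> real mat) \<Rightarrow> bool" where
  "parallel_decoder K N g \<longleftrightarrow>
     (\<exists>d h m r T Q Bs W b s.
        0 < d \<and> 0 < h \<and> 0 < m \<and> 0 < r \<and>
        T \<in> carrier_mat d K \<and> Q \<in> carrier_mat d N \<and>
        Bs \<noteq> [] \<and> (\<forall>B\<in>set Bs. block_dims d h m r B) \<and>
        W \<in> carrier_mat K d \<and> b \<in> carrier_vec K \<and>
        sampling_function K s \<and>
        g = (\<lambda>\<tau>. apply_cols s (g_pred W b Bs (g_enc T Q \<tau>))))"

definition decoder_chain :: "nat \<Rightarrow> nat \<Rightarrow> ((nat \<Rightarrow> nat) \<Rightarrow> real mat) \<Rightarrow> chain" where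
  "decoder_chain K N g =
     (\<lambda>\<tau>\<in>sequences K N. \<lambda>\<tau>'\<in>sequences K N. \<Prod>j<N. g \<tau> $$ (\<tau>' j, j))"

definition T_PD :: "nat \<Rightarrow> nat \<Rightarrow> chain set" where
  "T_PD K N = {decoder_chain K N g | g. parallel_decoder K N g}"

end

theory Submission
  imports Defs
begin

text \<open>One inclusion is Fubini for products of finite sums. For the other, one attention head
  already tells all pairs of a state and a position apart. Its score at position \<open>l\<close> is
  \<open>l ln K\<close> and its value is the token, so its output is the base \<open>K\<close> number with digits
  \<open>\<tau> l\<close> divided by the constant \<open>\<Sum>l<N. K ^ l\<close>. After rescaling, the first logit of column
  \<open>j\<close> is \<open>N\<close> times this number plus \<open>j\<close> plus a constant, and all other logits are 0. If
  \<open>K \<ge> 2\<close> then softmax is injective on such columns, and the sampling function may assign any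
  distribution to each of them; if \<open>K = 1\<close> there is only one distribution.\<close>

section \<open>Kernels with independent positions and their marginals\<close>

lemma finite_sequences [simp]: "finite (sequences K N)"
  unfolding sequences_def by (intro finite_PiE) auto

text \<open>A sum over all sequences of a product over positions is the product of the column sums.
  This gives total mass 1. With the token at position \<open>i\<close> fixed, every other factor
  sums to 1, so the marginals of the chain are exactly the columns of
  \<open>g \<tau>\<close>.\<close>

lemma product_chain_in_Prod_chains:
  assumes nonneg: "\<And>\<tau> j a. \<lbrakk>\<tau> \<in> sequences K N; j < N; a < K\<rbrakk> \<Longrightarrow> 0 \<le> (g \<tau> $$ (a, j) :: real)"
    and sum1: "\<And>\<tau> j. \<lbrakk>\<tau> \<in> sequences K N; j < N\<rbrakk> \<Longrightarrow> (\<Sum>a<K. g \<tau> $$ (a, j)) = 1"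
  shows "decoder_chain K N g \<in> Prod_chains K N"
proof -
  let ?P = "decoder_chain K N g"
  have P: "?P \<tau> \<tau>' = (\<Prod>j<N. g \<tau> $$ (\<tau>' j, j))"
    if "\<tau> \<in> sequences K N" "\<tau>' \<in> sequences K N" for \<tau> \<tau>'
    using that by (simp add: decoder_chain_def)
  have "(\<Sum>\<tau>'\<in>sequences K N. ?P \<tau> \<tau>') = 1" if \<tau>: "\<tau> \<in> sequences K N" for \<tau>
  proof -
    have "(\<Sum>\<tau>'\<in>sequences K N. ?P \<tau> \<tau>') = (\<Sum>\<tau>'\<in>sequences K N. \<Prod>j<N. g \<tau> $$ (\<tau>' j, j))"
      using P[OF \<tau>] by simp
    also have "\<dots> = (\<Prod>j<N. \<Sum>a<K. g \<tau> $$ (a, j))"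
      unfolding sequences_def by (simp add: prod_sum_PiE)
    finally show ?thesis using sum1[OF \<tau>] by simp
  qed
  moreover have "?P \<in> sequences K N \<rightarrow>\<^sub>E (sequences K N \<rightarrow>\<^sub>E {0..})"
  proof -
    have "0 \<le> (\<Prod>j<N. g \<tau> $$ (\<tau>' j, j))"
      if "\<tau> \<in> sequences K N" "\<tau>' \<in> sequences K N" for \<tau> \<tau>'
      using that(2) by (intro prod_nonneg ballI nonneg[OF that(1)]) (auto simp: sequences_def PiE_iff)
    then show ?thesis by (simp add: decoder_chain_def restrict_PiE_iff)
  qed
  moreover have "token_prob K N ?P \<tau> i a = g \<tau> $$ (a, i)"
    if \<tau>: "\<tau> \<in> sequences K N" and i: "i < N" and a: "a < K" for \<tau> i a
  proof -
    \<comment> \<open>The event that position \<open>i\<close> carries \<open>a\<close> is a box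
      whose side \<open>i\<close> is shrunk to a point, so the exchange of sum and product applies
      to it as well.\<close>
    let ?A = "\<lambda>j. if j = i then {a} else {..<K}"
    have eq: "{\<tau>' \<in> sequences K N. \<tau>' i = a} = Pi\<^sub>E {..<N} ?A"
    proof (intro equalityI subsetI)
      fix \<tau>' assume "\<tau>' \<in> {\<tau>' \<in> sequences K N. \<tau>' i = a}"
      then show "\<tau>' \<in> Pi\<^sub>E {..<N} ?A" by (simp add: sequences_def PiE_iff)
    next
      fix \<tau>' assume *: "\<tau>' \<in> Pi\<^sub>E {..<N} ?A"
      then have "\<tau>' j \<in> ?A j" if "j < N" for j using that by (simp add: PiE_iff)
      with * i a show "\<tau>' \<in> {\<tau>' \<in> sequences K N. \<tau>' i = a}"
        by (simp add: sequences_def PiE_iff) (metis lessThan_iff singletonD)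
    qed
    have "token_prob K N ?P \<tau> i a = (\<Sum>\<tau>'\<in>Pi\<^sub>E {..<N} ?A. \<Prod>j<N. g \<tau> $$ (\<tau>' j, j))"
      unfolding token_prob_def eq[symmetric] by (intro sum.cong refl P \<tau>) simp
    also have "\<dots> = (\<Prod>j<N. \<Sum>b\<in>?A j. g \<tau> $$ (b, j))"
      by (simp add: prod_sum_PiE)
    also have "\<dots> = (\<Prod>j<N. if j = i then g \<tau> $$ (a, i) else 1)"
      using sum1[OF \<tau>] by (intro prod.cong) auto
    also have "\<dots> = g \<tau> $$ (a, i)" using i by simp
    finally show ?thesis .
  qed
  ultimately show ?thesis
    by (simp add: Prod_chains_def markov_chain_def P sequences_def PiE_iff)
qed

section \<open>Matrix dimensions along the network\<close>

lemma bias_carrier [simp]: "b \<in> carrier_vec d \<Longrightarrow> bias b n \<in> carrier_mat d n"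
  by (auto simp: bias_def)

lemma softmax_carrier [simp]: "A \<in> carrier_mat m n \<Longrightarrow> softmax A \<in> carrier_mat m n"
  by (auto simp: softmax_def)

lemma ReLU_carrier [simp]: "A \<in> carrier_mat m n \<Longrightarrow> ReLU A \<in> carrier_mat m n"
  by (auto simp: ReLU_def)

lemma head_map_carrier [simp]:
  assumes "head_dims d m H" "X \<in> carrier_mat d n"
  shows "head_map H X \<in> carrier_mat d n"
  using assms unfolding head_map_def head_dims_def
  by (intro mult_carrier_mat[of _ d n] softmax_carrier mult_carrier_mat[of _ d m]
      mult_carrier_mat[of _ n m] mult_carrier_mat[of _ m d] transpose_carrier_mat[THEN iffD2]) auto

lemma Attn_carrier [simp]:
  assumes "\<And>H. H \<in> set Hs \<Longrightarrow> head_dims d m H" "X \<in> carrier_mat d n"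
  shows "Attn Hs X \<in> carrier_mat d n"
proof -
  have "foldr (\<lambda>H S. head_map H X + S) Hs (0\<^sub>m d n) \<in> carrier_mat d n"
    using assms(1) by (induction Hs) (simp_all add: head_map_carrier[OF _ assms(2)])
  then show ?thesis using assms(2) by (auto simp: Attn_def)
qed

lemma block_map_carrier [simp]:
  assumes B: "block_dims d h m r B" and X: "X \<in> carrier_mat d n"
  shows "block_map B X \<in> carrier_mat d n"
proof -
  have A: "Attn (heads B) X \<in> carrier_mat d n"
    using B X by (intro Attn_carrier) (auto simp: block_dims_def)
  show ?thesis using A B X
    by (auto simp: block_map_def Let_def block_dims_def
        intro!: add_carrier_mat mult_carrier_mat[of _ d r] ReLU_carrier bias_carrier)
qed

lemma transformer_carrier [simp]:
  assumes "\<And>B. B \<in> set Bs \<Longrightarrow> block_dims d h m r B" "X \<in> carrier_mat d n"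
  shows "transformer Bs X \<in> carrier_mat d n"
  using assms unfolding transformer_def
  by (induction Bs arbitrary: X) (auto intro: block_map_carrier)

section \<open>Softmax columns and sampling\<close>

text \<open>Each exponential is one of the positive summands of its denominator. The upper bound is
  attained when there is a single row. These bounds place every column in the domain on which
  \<open>sampling_function\<close> constrains \<open>s\<close>.\<close>

lemma softmax_bounds:
  assumes "i < dim_row A" "j < dim_col A"
  shows "0 < softmax A $$ (i, j)" "softmax A $$ (i, j) \<le> 1"
proof -
  let ?S = "\<Sum>l<dim_row A. exp (A $$ (l, j))"
  have "exp (A $$ (i, j)) \<le> ?S" using assms by (intro member_le_sum) auto
  moreover have "0 < ?S" using assms by (intro sum_pos) auto
  ultimately show "0 < softmax A $$ (i, j)" "softmax A $$ (i, j) \<le> 1"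
    using assms by (auto simp: softmax_def)
qed

text \<open>The common denominator of a column cancels. A softmax column therefore determines the
  differences of its logits, which is the form in which injectivity is used below.\<close>

lemma softmax_ratio:
  assumes "i < dim_row A" "i' < dim_row A" "j < dim_col A"
  shows "softmax A $$ (i, j) / softmax A $$ (i', j) = exp (A $$ (i, j) - A $$ (i', j))"
proof -
  have "0 < (\<Sum>l<dim_row A. exp (A $$ (l, j)))" using assms by (intro sum_pos) auto
  then show ?thesis using assms by (simp add: softmax_def exp_diff)
qed

lemma apply_cols_softmax_distribution:
  assumes s: "sampling_function K s" and A: "A \<in> carrier_mat K N" and j: "j < N"
  shows "a < K \<Longrightarrow> 0 \<le> apply_cols s (softmax A) $$ (a, j)"
    and "(\<Sum>a<K. apply_cols s (softmax A) $$ (a, j)) = 1"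
proof -
  have dims: "dim_row (softmax A) = K" "dim_col (softmax A) = N"
    using A by (auto simp: softmax_def)
  have "0 < col (softmax A) j $ i \<and> col (softmax A) j $ i \<le> 1" if "i < K" for i
    using softmax_bounds[of i A j] that j A dims by simp
  moreover have "col (softmax A) j \<in> carrier_vec K" using dims by (metis col_dim)
  ultimately have "(\<forall>i<K. 0 \<le> s (col (softmax A) j) $ i) \<and>
      (\<Sum>i<K. s (col (softmax A) j) $ i) = 1"
    using s unfolding sampling_function_def by blast
  then show "a < K \<Longrightarrow> 0 \<le> apply_cols s (softmax A) $$ (a, j)"
    and "(\<Sum>a<K. apply_cols s (softmax A) $$ (a, j)) = 1"
    using dims j by (auto simp: apply_cols_def)
qed

text \<open>Whatever the blocks compute, the logits form a \<open>K\<close> by \<open>N\<close>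
  matrix, so \<open>s\<close> receives softmax columns and returns a distribution for each
  position.\<close>

lemma T_PD_subset_Prod_chains: "T_PD K N \<subseteq> Prod_chains K N"
proof
  fix P assume "P \<in> T_PD K N"
  then obtain g where P: "P = decoder_chain K N g" and "parallel_decoder K N g"
    by (auto simp: T_PD_def)
  then obtain d h m r T Q Bs W b s where
    Q: "Q \<in> carrier_mat d N" and Bs: "\<And>B. B \<in> set Bs \<Longrightarrow> block_dims d h m r B"
    and W: "W \<in> carrier_mat K d" and b: "b \<in> carrier_vec K" and s: "sampling_function K s"
    and g: "g = (\<lambda>\<tau>. apply_cols s (g_pred W b Bs (g_enc T Q \<tau>)))"
    unfolding parallel_decoder_def by blast
  have X: "g_enc T Q \<tau> \<in> carrier_mat d N" for \<tau>
    using Q by (auto simp: g_enc_def)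
  have "W * transformer Bs (g_enc T Q \<tau>) + bias b (dim_col (g_enc T Q \<tau>)) \<in> carrier_mat K N" for \<tau>
    using X[of \<tau>] transformer_carrier[OF Bs X] W b by auto
  from apply_cols_softmax_distribution[OF s this]
  show "P \<in> Prod_chains K N"
    unfolding P g g_pred_def by (intro product_chain_in_Prod_chains)
qed

section \<open>Uniqueness of base \<open>K\<close> digits\<close>

lemma digit_sum_less:
  fixes K :: nat
  assumes "\<And>l. l < n \<Longrightarrow> f l < K"
  shows "(\<Sum>l<n. f l * K ^ l) < K ^ n"
  using assms
proof (induction n)
  case (Suc n)
  have "(f n + 1) * K ^ n \<le> K * K ^ n"
    using Suc.prems[of n] by (intro mult_right_mono) auto
  moreover have "(\<Sum>l<n. f l * K ^ l) < K ^ n" using Suc by simp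
  ultimately show ?case by (simp add: algebra_simps)
qed simp

text \<open>By \<open>digit_sum_less\<close> the lower digits sum to less than \<open>K ^ n\<close>,
  so they form the remainder, and the leading digit the quotient, on division by
  \<open>K ^ n\<close>. Induction then recovers the lower digits.\<close>

lemma digit_sum_inj:
  fixes K :: nat
  assumes "\<And>l. l < n \<Longrightarrow> f l < K" "\<And>l. l < n \<Longrightarrow> f' l < K"
    and "(\<Sum>l<n. f l * K ^ l) = (\<Sum>l<n. f' l * K ^ l)" and "l < n"
  shows "f l = f' l"
  using assms
proof (induction n arbitrary: l)
  case (Suc n)
  let ?S = "\<Sum>l<n. f l * K ^ l" and ?S' = "\<Sum>l<n. f' l * K ^ l"
  have less: "?S < K ^ n" "?S' < K ^ n"
    using Suc.prems by (auto intro: digit_sum_less)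
  have eq: "?S + f n * K ^ n = ?S' + f' n * K ^ n" using Suc.prems(3) by simp
  have "?S = ?S'"
    using arg_cong[OF eq, of "\<lambda>x. x mod K ^ n"] less by simp
  \<comment> \<open>Division needs \<open>K ^ n\<close> to be nonzero; \<open>K = 0\<close> is
    excluded by \<open>f n < K\<close>.\<close>
  moreover have "f n = f' n"
    using arg_cong[OF eq, of "\<lambda>x. x div K ^ n"] less Suc.prems(1)[of n] by (cases "K = 0") auto
  ultimately show ?case
    using Suc.IH[of l] Suc.prems by (cases "l = n") auto
qed simp

section \<open>An explicit one-block Transformer\<close>

definition token_embedding :: "nat \<Rightarrow> real mat" where
  "token_embedding K = mat 3 K (\<lambda>(i, a). if i = 0 then real a else 0)"

text \<open>Row 0 is left to the token. Row 1 numbers the positions. The constant row 2 supplies the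
  query of every column and later receives the attention output.\<close>

definition position_embedding :: "nat \<Rightarrow> real mat" where
  "position_embedding N = mat 3 N (\<lambda>(i, j). if i = 1 then real j else if i = 2 then 1 else 0)"

text \<open>All queries equal 1, so all columns attend with the same weights. The output goes to row
  2 alone, which keeps the position in row 1 intact.\<close>

definition digit_head :: "nat \<Rightarrow> head" where
  "digit_head K = \<lparr>
     W_O = mat 3 1 (\<lambda>(i, j). if i = 2 then 1 else 0),
     W_V = mat 1 3 (\<lambda>(i, j). if j = 0 then 1 else 0),
     W_K = mat 1 3 (\<lambda>(i, j). if j = 1 then ln (real K) else 0),
     W_Q = mat 1 3 (\<lambda>(i, j). if j = 2 then 1 else 0)\<rparr>"

text \<open>The feed-forward part is zero, so the block acts as its attention layer; its hidden size
  is 1 because widths must be positive.\<close>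

definition digit_block :: "nat \<Rightarrow> block" where
  "digit_block K = \<lparr>heads = [digit_head K],
     W_1 = 0\<^sub>m 1 3, b_1 = 0\<^sub>v 1, W_2 = 0\<^sub>m 3 1, b_2 = 0\<^sub>v 3\<rparr>"

text \<open>The sum of powers of \<open>K\<close> clears the softmax denominator, and the factor
  \<open>N\<close> leaves room for a position below \<open>N\<close> as a remainder. All rows but
  the first vanish and serve as reference logits.\<close>

definition digit_readout :: "nat \<Rightarrow> nat \<Rightarrow> real mat" where
  "digit_readout K N = mat K 3 (\<lambda>(i, j). if i = 0 then
     (if j = 1 then 1 else if j = 2 then real N * (\<Sum>l<N. real K ^ l) else 0) else 0)"

lemma digit_block_dims: "block_dims 3 1 1 1 (digit_block K)"
  by (simp add: block_dims_def head_dims_def digit_block_def digit_head_def)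

lemma sum_atLeastLessThan_0_3: "(\<Sum>i\<in>{0..<3}. f i) = f (0 :: nat) + f 1 + (f 2 :: real)"
  by (simp add: numeral_3_eq_3 numeral_2_eq_2)

lemma g_enc_embeddings:
  assumes "\<tau> \<in> sequences K N"
  shows "g_enc (token_embedding K) (position_embedding N) \<tau> =
    mat 3 N (\<lambda>(i, j). if i = 0 then real (\<tau> j) else if i = 1 then real j else 1)"
proof -
  have "\<tau> j < K" if "j < N" for j
    \<comment> \<open>The bound keeps the lookup of the token inside the \<open>K\<close> columns of
      the embedding.\<close>
    using assms that by (auto simp: sequences_def PiE_iff)
  then show ?thesis
    by (intro eq_matI) (auto simp: g_enc_def token_embedding_def position_embedding_def)
qed

lemma head_map_digit_head:
  fixes N :: nat
  assumes "0 < K"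
  defines "X \<equiv> \<lambda>\<tau>. mat 3 N (\<lambda>(i, j). if i = 0 then real (\<tau> j) else if i = 1 then real j else 1)"
  shows "head_map (digit_head K) (X \<tau>) = mat 3 N (\<lambda>(i, j). if i = 2 then
     real (\<Sum>l<N. \<tau> l * K ^ l) / (\<Sum>l<N. real K ^ l) else 0)"
proof -
  let ?H = "digit_head K"
  have V: "W_V ?H * X \<tau> = mat 1 N (\<lambda>(i, l). real (\<tau> l))"
    by (intro eq_matI) (auto simp: digit_head_def X_def scalar_prod_def sum_atLeastLessThan_0_3)
  have OV: "W_O ?H * (W_V ?H * X \<tau>) = mat 3 N (\<lambda>(i, l). if i = 2 then real (\<tau> l) else 0)"
    unfolding V by (intro eq_matI) (auto simp: digit_head_def scalar_prod_def)
  have Km: "W_K ?H * X \<tau> = mat 1 N (\<lambda>(i, l). ln (real K) * real l)"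
    by (intro eq_matI) (auto simp: digit_head_def X_def scalar_prod_def sum_atLeastLessThan_0_3)
  have Qm: "W_Q ?H * X \<tau> = mat 1 N (\<lambda>(i, l). 1)"
    by (intro eq_matI) (auto simp: digit_head_def X_def scalar_prod_def sum_atLeastLessThan_0_3)
  have KQ: "(W_K ?H * X \<tau>)\<^sup>T * (W_Q ?H * X \<tau>) = mat N N (\<lambda>(l, j). ln (real K) * real l)"
    unfolding Km Qm by (intro eq_matI) (auto simp: scalar_prod_def)
  \<comment> \<open>Positivity of \<open>K\<close> makes \<open>exp\<close> undo \<open>ln\<close>,
    which turns linear scores into powers.\<close>
  have exp: "exp (ln (real K) * real l) = real K ^ l" for l
    using assms(1) by (simp add: exp_of_nat2_mult)
  have S: "softmax ((W_K ?H * X \<tau>)\<^sup>T * (W_Q ?H * X \<tau>)) =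
      mat N N (\<lambda>(l, j). real K ^ l / (\<Sum>l<N. real K ^ l))"
    unfolding KQ by (intro eq_matI) (auto simp: softmax_def exp)
  define Z where "Z = (\<Sum>l<N. real K ^ l)"
  have "(\<Sum>l<N. real (\<tau> l) * (real K ^ l / Z)) = real (\<Sum>l<N. \<tau> l * K ^ l) / Z"
    by (simp add: sum_divide_distrib)
  then show ?thesis
    unfolding head_map_def OV S Z_def[symmetric]
    by (intro eq_matI) (simp_all add: scalar_prod_def atLeast0LessThan)
qed

lemma digit_block_logits:
  assumes "0 < K" and \<tau>: "\<tau> \<in> sequences K N"
  defines "X \<equiv> g_enc (token_embedding K) (position_embedding N) \<tau>"
  shows "digit_readout K N * transformer [digit_block K] X + bias (0\<^sub>v K) (dim_col X) =
    mat K N (\<lambda>(i, j). if i = 0 then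
      real (j + N * ((\<Sum>l<N. K ^ l) + (\<Sum>l<N. \<tau> l * K ^ l))) else 0)"
proof (cases "N = 0")
  \<comment> \<open>Without positions the denominator is an empty sum, hence 0, and cannot be
    cancelled. Both matrices then have no columns, and comparing dimensions suffices.\<close>
  case True
  have "transformer [digit_block K] X \<in> carrier_mat 3 N"
    using digit_block_dims
    by (intro transformer_carrier[where h=1 and m=1 and r=1])
      (auto simp: X_def g_enc_embeddings[OF \<tau>])
  moreover have "dim_col X = N" by (simp add: X_def g_enc_embeddings[OF \<tau>])
  ultimately show ?thesis
    using True by (intro eq_matI) (auto simp: digit_readout_def bias_def)
next
  case False
  define Z where "Z = (\<Sum>l<N. real K ^ l)"
  define C where "C = real (\<Sum>l<N. \<tau> l * K ^ l)"
  have Z: "0 < Z" unfolding Z_def using assms(1) False by (intro sum_pos) auto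
  have Xdims: "dim_row X = 3" "dim_col X = N" by (auto simp: X_def g_enc_embeddings[OF \<tau>])
  have hm: "head_map (digit_head K) X = mat 3 N (\<lambda>(i, j). if i = 2 then C / Z else 0)"
    unfolding X_def g_enc_embeddings[OF \<tau>] head_map_digit_head[OF assms(1)] C_def Z_def ..
  have A: "Attn [digit_head K] X = mat 3 N (\<lambda>(i, j). if i = 0 then real (\<tau> j)
      else if i = 1 then real j else 1 + C / Z)"
    unfolding Attn_def Xdims by (intro eq_matI) (auto simp: hm, auto simp: X_def g_enc_embeddings[OF \<tau>])
  have t: "transformer [digit_block K] X = mat 3 N (\<lambda>(i, j). if i = 0 then real (\<tau> j)
      else if i = 1 then real j else 1 + C / Z)"
    unfolding transformer_def
    by (intro eq_matI)
      (auto simp: block_map_def digit_block_def A Let_def Xdims bias_def ReLU_def scalar_prod_def)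
  \<comment> \<open>Row 2 now holds \<open>1 + C / Z\<close>; scaling by \<open>N * Z\<close> makes
    the logit a natural number.\<close>
  have "real j + real N * Z * (1 + C / Z) =
      real (j + N * ((\<Sum>l<N. K ^ l) + (\<Sum>l<N. \<tau> l * K ^ l)))" for j
  proof -
    have "real j + real N * Z * (1 + C / Z) = real j + real N * (Z + C)"
      using Z by (simp add: field_simps)
    then show ?thesis by (simp add: Z_def C_def)
  qed
  note logit = this[symmetric]
  show ?thesis
    unfolding t logit
    by (intro eq_matI)
      (simp_all add: digit_readout_def Xdims bias_def scalar_prod_def sum_atLeastLessThan_0_3 Z_def)
qed

section \<open>Separating columns and prescribing distributions\<close>

definition digit_pred :: "nat \<Rightarrow> nat \<Rightarrow> (nat \<Rightarrow> nat) \<Rightarrow> real mat" where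
  "digit_pred K N \<tau> = g_pred (digit_readout K N) (0\<^sub>v K) [digit_block K]
     (g_enc (token_embedding K) (position_embedding N) \<tau>)"

text \<open>Since \<open>2 \<le> K\<close>, row 1 exists and has logit 0, so the ratio of the first
  two entries is the exponential of the first logit. That logit encodes the position modulo
  \<open>N\<close> and the digits of the state in the quotient.\<close>

lemma digit_pred_col_inj:
  assumes K: "2 \<le> K" and \<tau>: "\<tau> \<in> sequences K N" "\<tau>' \<in> sequences K N" and j: "j < N" "j' < N"
    and eq: "col (digit_pred K N \<tau>) j = col (digit_pred K N \<tau>') j'"
  shows "\<tau> = \<tau>' \<and> j = j'"
proof -
  let ?Z = "\<Sum>l<N. K ^ l"
  let ?C = "\<lambda>\<tau>. \<Sum>l<N. \<tau> l * K ^ l"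
  define L where "L \<tau> = mat K N (\<lambda>(i, j). if i = 0 then real (j + N * (?Z + ?C \<tau>)) else 0)" for \<tau>
  have p: "digit_pred K N \<rho> = softmax (L \<rho>)" if "\<rho> \<in> sequences K N" for \<rho>
    unfolding digit_pred_def g_pred_def L_def using K that by (subst digit_block_logits) auto
  have dims: "dim_row (softmax (L \<rho>)) = K" "dim_col (softmax (L \<rho>)) = N" for \<rho>
    by (auto simp: softmax_def L_def)
  have "softmax (L \<tau>) $$ (i, j) = softmax (L \<tau>') $$ (i, j')" if "i < K" for i
    using arg_cong[OF eq, of "\<lambda>v. v $ i"] that j dims by (simp add: p \<tau>)
  then have "softmax (L \<tau>) $$ (0, j) / softmax (L \<tau>) $$ (1, j) =
      softmax (L \<tau>') $$ (0, j') / softmax (L \<tau>') $$ (1, j')"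
    using K by simp
  then have "exp (real (j + N * (?Z + ?C \<tau>))) = exp (real (j' + N * (?Z + ?C \<tau>')))"
    using K j by (subst (asm) (1 2) softmax_ratio) (simp_all add: L_def)
  then have *: "j + N * (?Z + ?C \<tau>) = j' + N * (?Z + ?C \<tau>')" by (simp only: exp_inj_iff of_nat_eq_iff)
  have "j = j'" using arg_cong[OF *, of "\<lambda>x. x mod N"] j by simp
  moreover from this have "?C \<tau> = ?C \<tau>'" using * j by simp
  then have "\<tau> = \<tau>'"
    using \<tau> by (intro PiE_ext[of _ "{..<N}" "\<lambda>_. {..<K}"] digit_sum_inj[of N \<tau> K \<tau>'])
      (auto simp: sequences_def PiE_mem)
  ultimately show ?thesis by simp
qed

text \<open>The sampling function acts as a lookup table: it decodes a column to the state and
  position that produced it and returns the prescribed distribution \<open>q\<close>.\<close>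

lemma exists_parallel_decoder:
  assumes K: "0 < K"
    and nonneg: "\<And>\<tau> j a. \<lbrakk>\<tau> \<in> sequences K N; j < N; a < K\<rbrakk> \<Longrightarrow> 0 \<le> q \<tau> j a"
    and sum1: "\<And>\<tau> j. \<lbrakk>\<tau> \<in> sequences K N; j < N\<rbrakk> \<Longrightarrow> (\<Sum>a<K. q \<tau> j a) = 1"
  obtains g where "parallel_decoder K N g"
    and "\<And>\<tau> j a. \<lbrakk>\<tau> \<in> sequences K N; j < N; a < K\<rbrakk> \<Longrightarrow> g \<tau> $$ (a, j) = q \<tau> j a"
proof -
  let ?D = "sequences K N \<times> {..<N}"
  define c where "c = (\<lambda>(\<tau>, j). col (digit_pred K N \<tau>) j)"
  \<comment> \<open>Off the image of \<open>c\<close> the default is the point mass at token 0, a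
    distribution because \<open>0 < K\<close>.\<close>
  define s where "s p = vec K (\<lambda>a. if p \<in> c ` ?D
    then case inv_into ?D c p of (\<tau>, j) \<Rightarrow> q \<tau> j a else if a = 0 then 1 else 0)" for p
  have inv: "inv_into ?D c p \<in> ?D" if "p \<in> c ` ?D" for p
    using that by (rule inv_into_into)
  have "sampling_function K s"
    unfolding sampling_function_def
  proof (intro ballI impI)
    fix p :: "real vec"
    show "s p \<in> carrier_vec K \<and> (\<forall>i<K. 0 \<le> s p $ i) \<and> (\<Sum>i<K. s p $ i) = 1"
    proof (cases "p \<in> c ` ?D")
      case True
      obtain \<tau> j where "inv_into ?D c p = (\<tau>, j)" "\<tau> \<in> sequences K N" "j < N"
        using inv[OF True] by (cases "inv_into ?D c p") auto
      then show ?thesis using True nonneg sum1 by (simp add: s_def)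
    next
      case False
      then show ?thesis using K by (simp add: s_def)
    qed
  qed
  \<comment> \<open>The witnesses are embedding width 3 and one block with one head, head size 1 and
    hidden size 1.\<close>
  then have "parallel_decoder K N (\<lambda>\<tau>. apply_cols s (digit_pred K N \<tau>))"
    unfolding parallel_decoder_def digit_pred_def
    by (intro exI[of _ 3] exI[of _ 1] exI[of _ "token_embedding K"]
        exI[of _ "position_embedding N"] exI[of _ "[digit_block K]"] exI[of _ "digit_readout K N"]
        exI[of _ "0\<^sub>v K"] exI[of _ s])
      (auto simp: digit_block_dims token_embedding_def position_embedding_def digit_readout_def
        simp del: One_nat_def)
  moreover have "apply_cols s (digit_pred K N \<tau>) $$ (a, j) = q \<tau> j a"
    if "\<tau> \<in> sequences K N" "j < N" "a < K" for \<tau> j a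
  proof -
    have dims: "dim_row (digit_pred K N \<tau>) = K" "dim_col (digit_pred K N \<tau>) = N"
      using digit_block_logits[OF K that(1)]
      by (simp_all add: digit_pred_def g_pred_def softmax_def)
    have mem: "c (\<tau>, j) \<in> c ` ?D" using that by blast
    obtain \<tau>' j' where inv': "inv_into ?D c (c (\<tau>, j)) = (\<tau>', j')" by fastforce
    with inv[OF mem] f_inv_into_f[OF mem] have
      \<tau>': "\<tau>' \<in> sequences K N" "j' < N" "c (\<tau>', j') = c (\<tau>, j)" by auto
    \<comment> \<open>The decoded pair is only known to share its column with the original one. For
      \<open>2 \<le> K\<close> the two pairs coincide; for \<open>K = 1\<close> they may differ, but
      both distributions are the point mass.\<close>
    have "q \<tau>' j' a = q \<tau> j a"
    proof (cases "2 \<le> K")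
      case True
      from digit_pred_col_inj[OF True \<tau>'(1) that(1) \<tau>'(2) that(2)] \<tau>'(3)
      show ?thesis by (simp add: c_def)
    next
      case False
      then have "K = 1" using K by simp
      then show ?thesis using sum1[OF \<tau>'(1,2)] sum1[OF that(1,2)] that(3) by simp
    qed
    then show ?thesis
      using that dims mem inv' by (simp add: apply_cols_def s_def c_def)
  qed
  ultimately show thesis by (rule that)
qed

section \<open>Recovering a chain from its marginals\<close>

text \<open>The marginals of a product chain are distributions, so some decoder has them as its
  columns; their product is the chain. For \<open>K = 0\<close> no sampling function exists, as an
  empty sum is not 1.\<close>

lemma Prod_chains_subset_T_PD:
  assumes K: "0 < K"
  shows "Prod_chains K N \<subseteq> T_PD K N"
proof
  fix P assume "P \<in> Prod_chains K N"
  then have P: "P \<in> sequences K N \<rightarrow>\<^sub>E (sequences K N \<rightarrow>\<^sub>E {0..})"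
    and sum1: "\<And>\<tau>. \<tau> \<in> sequences K N \<Longrightarrow> (\<Sum>\<tau>'\<in>sequences K N. P \<tau> \<tau>') = 1"
    and prod: "\<And>\<tau> \<tau>'. \<lbrakk>\<tau> \<in> sequences K N; \<tau>' \<in> sequences K N\<rbrakk> \<Longrightarrow>
      P \<tau> \<tau>' = (\<Prod>i<N. token_prob K N P \<tau> i (\<tau>' i))"
    by (auto simp: Prod_chains_def markov_chain_def)
  have nonneg: "0 \<le> P \<tau> \<tau>'" if "\<tau> \<in> sequences K N" "\<tau>' \<in> sequences K N" for \<tau> \<tau>'
    using PiE_mem[OF PiE_mem[OF P that(1)] that(2)] by simp
  have token_nonneg: "0 \<le> token_prob K N P \<tau> j a" if "\<tau> \<in> sequences K N" for \<tau> j a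
    unfolding token_prob_def using that by (intro sum_nonneg) (auto intro: nonneg)
  have token_sum: "(\<Sum>a<K. token_prob K N P \<tau> j a) = 1"
    if "\<tau> \<in> sequences K N" "j < N" for \<tau> j
  proof -
    have "(\<lambda>\<tau>'. \<tau>' j) ` sequences K N \<subseteq> {..<K}"
      using that(2) by (auto simp: sequences_def PiE_iff)
    \<comment> \<open>The token at position \<open>j\<close> partitions the next states into
      \<open>K\<close> classes.\<close>
    then have "(\<Sum>a<K. token_prob K N P \<tau> j a) = (\<Sum>\<tau>'\<in>sequences K N. P \<tau> \<tau>')"
      unfolding token_prob_def by (intro sum.group) auto
    then show ?thesis using sum1[OF that(1)] by simp
  qed
  obtain g where g: "parallel_decoder K N g"
    and q: "\<And>\<tau> j a. \<lbrakk>\<tau> \<in> sequences K N; j < N; a < K\<rbrakk> \<Longrightarrow>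
      g \<tau> $$ (a, j) = token_prob K N P \<tau> j a"
    using exists_parallel_decoder[OF K, where q = "token_prob K N P"] token_nonneg token_sum by metis
  have "decoder_chain K N g = P"
  \<comment> \<open>Both chains are extensional in each argument, so agreement on pairs of states
    gives equality of functions.\<close>
  proof (rule PiE_ext)
    show "decoder_chain K N g \<in> sequences K N \<rightarrow>\<^sub>E (sequences K N \<rightarrow>\<^sub>E UNIV)"
      by (auto simp: decoder_chain_def)
    show "P \<in> sequences K N \<rightarrow>\<^sub>E (sequences K N \<rightarrow>\<^sub>E UNIV)"
      using P by (auto simp: PiE_iff)
  next
    fix \<tau> assume \<tau>: "\<tau> \<in> sequences K N"
    show "decoder_chain K N g \<tau> = P \<tau>"
    proof (rule extensionalityI[where A = "sequences K N"])
      show "decoder_chain K N g \<tau> \<in> extensional (sequences K N)"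
        using \<tau> by (simp add: decoder_chain_def)
      show "P \<tau> \<in> extensional (sequences K N)"
        using PiE_mem[OF P \<tau>] by (simp add: PiE_iff)
      fix \<tau>' assume \<tau>': "\<tau>' \<in> sequences K N"
      then have "\<tau>' j < K" if "j < N" for j using that by (auto simp: sequences_def PiE_iff)
      then show "decoder_chain K N g \<tau> \<tau>' = P \<tau> \<tau>'"
        unfolding prod[OF \<tau> \<tau>'] using \<tau> \<tau>' by (auto simp: decoder_chain_def q intro!: prod.cong)
    qed
  qed
  with g show "P \<in> T_PD K N" by (auto simp: T_PD_def)
qed

theorem proposition10:
  fixes K N :: nat
  assumes "0 < K"
  shows "T_PD K N = Prod_chains K N"
  using T_PD_subset_Prod_chains Prod_chains_subset_T_PD[OF assms] by blast

end
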